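(* Let $p,q,r,s\ge 1$ and let $1\le a_1\le\cdots\le a_r$ and $1\le b_1\le\cdots\le b_s$ be integers. The tree $T=T^{p,q}(a_1,\dots,a_r;b_1,\dots,b_s)$ has exactly three main eigenvalues if and only if $T\in\mathcal T$ (up to isomorphism), where $$\mathcal T=\left\{T_{\delta(\eta-\kappa)}^{\kappa^2-\delta(\eta-\kappa)}\left(\frac{\kappa^3}{\eta}\right)\;\middle|\;\eta\mid\kappa^3,\ 1\le\delta(\eta-\kappa)\le\kappa^2-1\right\},$$ with $\kappa\ge2$ and $\eta\ge1$ ranging over integers and $\delta\in\{1,-1\}$.
   Context: All graphs are finite, simple and undirected. An eigenvalue $\lambda$ of the adjacency matrix of a graph $G$ is a main eigenvalue if its eigenspace is not orthogonal to the all-ones vector $\mathbf j$; the number of main eigenvalues counts distinct ones. For integers $r,s\ge1$, $p,q\ge 0$, $1\le a_1\le\cdots\le a_r$, $1\le b_1\le\cdots\le b_s$, the tree $T^{p,q}(a_1,\dots,a_r;b_1,\dots,b_s)$ (of diameter 5) consists of two adjacent vertices $u_1,u_2$; vertices $w_1,\dots,w_r$ adjacent to $u_1$, where $w_i$ is additionally adjacent to $a_i$ pendant vertices; vertices $z_1,\dots,z_s$ adjacent to $u_2$, where $z_j$ is additionally adjacent to $b_j$ pendant vertices; $p$ pendant vertices adjacent to $u_1$; and $q$ pendant vertices adjacent to $u_2$. There are no other vertices or edges. The symmetric tree $T_r^p(a)$ is the case $p=q$, $r=s$, $a_i=b_j=a$ for all $i,j$. *)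

theory Defs
  imports "Graph_Theory.Graph_Theory" "Jordan_Normal_Form.Char_Poly"
begin

text \<open>
  A finite simple undirected graph is a symmetric, loop-free finite digraph without parallel arcs,
  i.e. an instance of \<^locale>\<open>pair_graph\<close>: an edge between u and v is the pair of arcs
  (u, v), (v, u).
\<close>

section \<open>Main eigenvalues\<close>

definition adjacency_mat :: "'v list \<Rightarrow> 'v pair_pre_digraph \<Rightarrow> real mat" where
  "adjacency_mat vs G =
     mat (length vs) (length vs) (\<lambda>(i, j). if (vs ! i, vs ! j) \<in> parcs G then 1 else 0)"

definition ones_vec :: "nat \<Rightarrow> real vec" where
  "ones_vec n = vec n (\<lambda>_. 1)"

definition eigenspace :: "real mat \<Rightarrow> real \<Rightarrow> real vec set" where
  "eigenspace A \<mu> = {x \<in> carrier_vec (dim_row A). A *\<^sub>v x = \<mu> \<cdot>\<^sub>v x}"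

definition main_eigenvalue_mat :: "real mat \<Rightarrow> real \<Rightarrow> bool" where
  "main_eigenvalue_mat A \<mu> \<longleftrightarrow>
     eigenvalue A \<mu> \<and> \<not> (\<forall>x \<in> eigenspace A \<mu>. x \<bullet> ones_vec (dim_row A) = 0)"

text \<open>
  Matrices in \<^theory>\<open>Jordan_Normal_Form.Matrix\<close> are indexed by natural numbers, so the adjacency
  matrix needs an enumeration of the vertices. One is chosen here; by \<open>main_eigenvalue_iff\<close> below
  the choice does not matter.
\<close>

definition vertex_list :: "'v pair_pre_digraph \<Rightarrow> 'v list" where
  "vertex_list G = (SOME vs. distinct vs \<and> set vs = pverts G)"

definition main_eigenvalue :: "'v pair_pre_digraph \<Rightarrow> real \<Rightarrow> bool" where
  "main_eigenvalue G \<mu> \<longleftrightarrow> main_eigenvalue_mat (adjacency_mat (vertex_list G) G) \<mu>"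

definition num_main_eigenvalues :: "'v pair_pre_digraph \<Rightarrow> nat" where
  "num_main_eigenvalues G = card {\<mu>. main_eigenvalue G \<mu>}"

lemma dim_row_adjacency_mat [simp]: "dim_row (adjacency_mat vs G) = length vs"
  by (simp add: adjacency_mat_def)

lemma main_eigenvalue_mat_adjacency_mat:
  assumes "distinct vs"
  shows "main_eigenvalue_mat (adjacency_mat vs G) \<mu> \<longleftrightarrow>
    (\<exists>f. (\<forall>v \<in> set vs. (\<Sum>w \<in> {w \<in> set vs. (v, w) \<in> parcs G}. f w) = \<mu> * f v) \<and>
         (\<Sum>v \<in> set vs. f v) \<noteq> 0)"
    (is "_ \<longleftrightarrow> ?R")
proof -
  let ?n = "length vs" and ?A = "adjacency_mat vs G"
  have nth_sum: "(\<Sum>i = 0..<?n. g (vs ! i)) = (\<Sum>v \<in> set vs. g v)" for g :: "'a \<Rightarrow> real"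
  proof -
    have "bij_betw ((!) vs) {0..<?n} (set vs)"
      by (rule bij_betw_nth[OF assms]) (auto simp: atLeast0LessThan)
    then show ?thesis by (rule sum.reindex_bij_betw)
  qed
  have row: "(?A *\<^sub>v vec ?n (\<lambda>i. f (vs ! i))) $ i =
      (\<Sum>w \<in> {w \<in> set vs. (vs ! i, w) \<in> parcs G}. f w)" if "i < ?n" for f i
  proof -
    have "(?A *\<^sub>v vec ?n (\<lambda>i. f (vs ! i))) $ i =
        (\<Sum>j = 0..<?n. (if (vs ! i, vs ! j) \<in> parcs G then 1 else 0) * f (vs ! j))"
      using that by (simp add: adjacency_mat_def scalar_prod_def)
    also have "\<dots> = (\<Sum>w \<in> set vs. (if (vs ! i, w) \<in> parcs G then 1 else 0) * f w)"
      by (rule nth_sum)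
    also have "\<dots> = (\<Sum>w \<in> set vs. if (vs ! i, w) \<in> parcs G then f w else 0)"
      by (rule sum.cong) auto
    also have "\<dots> = (\<Sum>w \<in> {w \<in> set vs. (vs ! i, w) \<in> parcs G}. f w)"
      by (rule sum.inter_filter[symmetric]) simp
    finally show ?thesis .
  qed
  have eig: "vec ?n (\<lambda>i. f (vs ! i)) \<in> eigenspace ?A \<mu> \<longleftrightarrow>
      (\<forall>v \<in> set vs. (\<Sum>w \<in> {w \<in> set vs. (v, w) \<in> parcs G}. f w) = \<mu> * f v)" for f
  proof -
    have "vec ?n (\<lambda>i. f (vs ! i)) \<in> eigenspace ?A \<mu> \<longleftrightarrow>
        (\<forall>i < ?n. (?A *\<^sub>v vec ?n (\<lambda>i. f (vs ! i))) $ i = \<mu> * f (vs ! i))"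
      by (auto simp: eigenspace_def vec_eq_iff simp del: index_mult_mat_vec)
    then show ?thesis by (simp add: row all_set_conv_all_nth del: index_mult_mat_vec)
  qed
  have ones: "vec ?n (\<lambda>i. f (vs ! i)) \<bullet> ones_vec ?n = (\<Sum>v \<in> set vs. f v)" for f
    using nth_sum[of f] by (simp add: scalar_prod_def ones_vec_def)
  have ex_f: "\<exists>f. x = vec ?n (\<lambda>i. f (vs ! i))" if "x \<in> carrier_vec ?n" for x :: "real vec"
  proof -
    let ?f = "\<lambda>v. x $ the_inv_into {..<?n} ((!) vs) v"
    have "inj_on ((!) vs) {..<?n}" using assms by (simp add: inj_on_nth)
    then have "x = vec ?n (\<lambda>i. ?f (vs ! i))"
      using that by (auto simp: vec_eq_iff the_inv_into_f_f)
    then show ?thesis by (rule exI[of _ ?f])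
  qed
  have "main_eigenvalue_mat ?A \<mu> \<longleftrightarrow> (\<exists>x \<in> eigenspace ?A \<mu>. x \<bullet> ones_vec ?n \<noteq> 0)"
  proof -
    have "eigenvalue ?A \<mu>" if "x \<in> eigenspace ?A \<mu>" "x \<bullet> ones_vec ?n \<noteq> 0" for x
      using that unfolding eigenvalue_def eigenvector_def eigenspace_def
      by (auto simp: ones_vec_def)
    then show ?thesis by (auto simp: main_eigenvalue_mat_def)
  qed
  also have "\<dots> \<longleftrightarrow> ?R"
  proof
    assume "\<exists>x \<in> eigenspace ?A \<mu>. x \<bullet> ones_vec ?n \<noteq> 0"
    then obtain x where x: "x \<in> eigenspace ?A \<mu>" "x \<bullet> ones_vec ?n \<noteq> 0" by blast
    then have "x \<in> carrier_vec ?n" by (simp add: eigenspace_def)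
    with ex_f obtain f where "x = vec ?n (\<lambda>i. f (vs ! i))" by blast
    with x eig[of f] ones[of f] show ?R by auto
  next
    assume ?R
    then show "\<exists>x \<in> eigenspace ?A \<mu>. x \<bullet> ones_vec ?n \<noteq> 0"
      using eig ones by metis
  qed
  finally show ?thesis .
qed

lemma main_eigenvalue_iff:
  assumes "distinct vs" "set vs = pverts G"
  shows "main_eigenvalue G \<mu> \<longleftrightarrow> main_eigenvalue_mat (adjacency_mat vs G) \<mu>"
proof -
  have "distinct (vertex_list G) \<and> set (vertex_list G) = pverts G"
    unfolding vertex_list_def by (rule someI[of _ vs]) (use assms in simp)
  with assms show ?thesis
    by (simp add: main_eigenvalue_def main_eigenvalue_mat_adjacency_mat)
qed

section \<open>The trees of diameter 5\<close>

text \<open>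
  \<open>PendU1 k\<close> and \<open>PendU2 k\<close> are the pendant neighbours of \<open>U1\<close> and \<open>U2\<close>; \<open>PendW i k\<close> is the
  k-th pendant neighbour of \<open>W i\<close>, and likewise \<open>PendZ j k\<close> of \<open>Z j\<close>. Indices start at 0.
\<close>

datatype tree_vertex =
    U1 | U2 | W nat | Z nat | PendW nat nat | PendZ nat nat | PendU1 nat | PendU2 nat

definition tree_vertices :: "nat \<Rightarrow> nat \<Rightarrow> nat list \<Rightarrow> nat list \<Rightarrow> tree_vertex set" where
  "tree_vertices p q a b =
     {U1, U2} \<union>
     {W i | i. i < length a} \<union> {PendW i k | i k. i < length a \<and> k < a ! i} \<union>
     {Z j | j. j < length b} \<union> {PendZ j k | j k. j < length b \<and> k < b ! j} \<union>
     {PendU1 k | k. k < p} \<union> {PendU2 k | k. k < q}"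

definition tree_arcs :: "nat \<Rightarrow> nat \<Rightarrow> nat list \<Rightarrow> nat list \<Rightarrow> tree_vertex rel" where
  "tree_arcs p q a b =
     {(U1, U2)} \<union>
     {(U1, W i) | i. i < length a} \<union> {(W i, PendW i k) | i k. i < length a \<and> k < a ! i} \<union>
     {(U2, Z j) | j. j < length b} \<union> {(Z j, PendZ j k) | j k. j < length b \<and> k < b ! j} \<union>
     {(U1, PendU1 k) | k. k < p} \<union> {(U2, PendU2 k) | k. k < q}"

definition diam5_tree ::
    "nat \<Rightarrow> nat \<Rightarrow> nat list \<Rightarrow> nat list \<Rightarrow> tree_vertex pair_pre_digraph" where
  "diam5_tree p q a b =
     \<lparr>pverts = tree_vertices p q a b, parcs = tree_arcs p q a b \<union> (tree_arcs p q a b)\<inverse>\<rparr>"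

definition sym_tree :: "nat \<Rightarrow> nat \<Rightarrow> nat \<Rightarrow> tree_vertex pair_pre_digraph" where
  "sym_tree p r a = diam5_tree p p (replicate r a) (replicate r a)"

lemma pair_graph_diam5_tree: "pair_graph (diam5_tree p q a b)"
proof -
  have fin: "finite (tree_vertices p q a b)"
  proof -
    have "{PendW i k | i k. i < length a \<and> k < a ! i} =
        (\<Union>i \<in> {..<length a}. PendW i ` {..<a ! i})"
      "{PendZ j k | j k. j < length b \<and> k < b ! j} =
        (\<Union>j \<in> {..<length b}. PendZ j ` {..<b ! j})"
      by auto
    then show ?thesis by (simp add: tree_vertices_def)
  qed
  have sub: "tree_arcs p q a b \<subseteq> tree_vertices p q a b \<times> tree_vertices p q a b"
    by (auto simp: tree_arcs_def tree_vertices_def)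
  have irr: "u \<noteq> v" if "(u, v) \<in> tree_arcs p q a b" for u v
    using that by (auto simp: tree_arcs_def)
  show ?thesis
  proof
    show "symmetric (diam5_tree p q a b)"
      by (auto simp: symmetric_def diam5_tree_def sym_def)
    show "finite (parcs (diam5_tree p q a b))"
      using finite_subset[OF sub] fin by (simp add: diam5_tree_def)
  qed (use sub irr fin in \<open>fastforce simp: diam5_tree_def\<close>)+
qed

text \<open>
  The family consists of the trees \<open>sym_tree p r a\<close> with \<open>r = \<delta> * (\<eta> - \<kappa>)\<close>,
  \<open>p = \<kappa>\<^sup>2 - r\<close> and \<open>a = \<kappa>\<^sup>3 div \<eta>\<close>. The arithmetic is done in the integers; the side
  conditions make all three parameters positive and the division exact, so \<open>nat\<close> truncates nothing.
\<close>

definition three_main_family :: "tree_vertex pair_pre_digraph set" where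
  "three_main_family =
     {sym_tree (nat (\<kappa>^2 - \<delta> * (\<eta> - \<kappa>))) (nat (\<delta> * (\<eta> - \<kappa>))) (nat (\<kappa>^3 div \<eta>)) |
        \<kappa> \<eta> \<delta> :: int.
        \<kappa> \<ge> 2 \<and> \<eta> \<ge> 1 \<and> \<delta> \<in> {1, -1} \<and> \<eta> dvd \<kappa>^3 \<and>
        1 \<le> \<delta> * (\<eta> - \<kappa>) \<and> \<delta> * (\<eta> - \<kappa>) \<le> \<kappa>^2 - 1}"

end

theory Submission
  imports Defs
begin

text \<open>
  The number of main eigenvalues of a graph with adjacency matrix \<open>A\<close> is the least degree of a nonzero
  polynomial \<open>P\<close> with \<open>P(A) j = 0\<close>, where \<open>j\<close> is the all-ones vector
  (\<open>num_main_eigenvalues_eq_minimal_degree\<close>). Instead of diagonalising \<open>A\<close>, take such a \<open>P\<close> of least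
  degree, a complex root \<open>c\<close> of it, and write \<open>P = (x - c) Q\<close>. By minimality \<open>v = Q(A) j\<close> is nonzero,
  and \<open>A v = c v\<close>, so \<open>c\<close> is real. As \<open>A\<close> is symmetric, \<open>\<langle>v, v\<rangle> = \<langle>Q(A) j, v\<rangle> = Q(c) \<langle>j, v\<rangle>\<close>. The left
  side does not vanish, hence neither does \<open>Q(c)\<close>, so the root is simple, nor \<open>\<langle>j, v\<rangle>\<close>, so \<open>c\<close> is a
  main eigenvalue. Conversely every main eigenvalue is a root of every \<open>P\<close> that annihilates \<open>j\<close>.

  So there are exactly three main eigenvalues if and only if the walk counts \<open>j\<close>, \<open>A j\<close>, \<open>A\<^sup>2 j\<close> are linearly
  independent and \<open>A\<^sup>3 j = \<alpha> A\<^sup>2 j + \<beta> A j + \<gamma> j\<close> for some coefficients. For a tree of diameter 5 with \<open>p\<close> and \<open>q\<close>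
  positive, comparing this equation at \<open>w\<^sub>i\<close> and at a pendant neighbour of \<open>u\<^sub>1\<close> gives
  \<open>a\<^sub>i = \<alpha> + \<beta> - 1\<close>. Likewise \<open>b\<^sub>j = \<alpha> + \<beta> - 1\<close>, so all these numbers are equal, and the equations at the
  pendant vertices then force \<open>r = s\<close> and \<open>p = q\<close> (\<open>diam5_tree_cubic_imp_symmetric\<close>).

  In a symmetric tree the equation takes only four different forms. With \<open>m = r + p\<close> and
  \<open>t = \<alpha> - 1\<close> they amount to \<open>r a = t (m - a)\<close> and \<open>m = t\<^sup>2\<close>, that is \<open>t\<^sup>2 = r + p\<close> and
  \<open>a (r + t) = t\<^sup>3\<close> (\<open>sym_tree_cubic_iff\<close>). The number \<open>t\<close> is rational with an integral square,
  hence an integer. Putting \<open>\<kappa> = \<bar>t\<bar>\<close>, \<open>\<delta> = sgn t\<close> and \<open>\<eta> = \<kappa> + \<delta> r\<close> turns these two equations into the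
  parametrisation of the family (\<open>three_main_family_eq\<close>).
\<close>

section \<open>Main eigenvalues and annihilators of the all-ones vector\<close>

text \<open>
  There is one unknown more than there are equations. A zero row makes the system square, and its
  determinant vanishes.
\<close>

lemma exists_linear_relation:
  fixes g :: "nat \<Rightarrow> 'v \<Rightarrow> complex"
  assumes "finite V"
  shows "\<exists>c. (\<exists>i \<le> card V. c i \<noteq> 0) \<and> (\<forall>v \<in> V. (\<Sum>i \<le> card V. c i * g i v) = 0)"
proof -
  define n where "n = card V"
  from assms obtain h where h: "bij_betw h {0..<n} V"
    unfolding n_def using ex_bij_betw_nat_finite by blast
  define A where "A = mat (Suc n) (Suc n) (\<lambda>(i, j). if i < n then g j (h i) else 0)"
  have A: "A \<in> carrier_mat (Suc n) (Suc n)" by (simp add: A_def)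
  have "det A = (\<Sum>j<Suc n. A $$ (n, j) * cofactor A n j)"
    by (rule laplace_expansion_row[OF A]) simp
  also have "\<dots> = 0" by (rule sum.neutral) (auto simp: A_def)
  finally obtain c where c: "c \<in> carrier_vec (Suc n)" "c \<noteq> 0\<^sub>v (Suc n)"
      "A *\<^sub>v c = 0\<^sub>v (Suc n)"
    using det_0_iff_vec_prod_zero[OF A] by auto
  have "(\<Sum>i\<le>n. c $ i * g i v) = 0" if "v \<in> V" for v
  proof -
    have "v \<in> h ` {0..<n}" using h that by (simp add: bij_betw_def)
    then obtain i where i: "i < n" "v = h i" by auto
    have "0 = (A *\<^sub>v c) $ i" using i c(3) by simp
    also have "\<dots> = (\<Sum>j\<in>{0..<Suc n}. A $$ (i, j) * c $ j)"
      using i c(1) by (simp add: A_def scalar_prod_def)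
    also have "\<dots> = (\<Sum>j\<le>n. c $ j * g j v)"
      by (rule sum.cong) (use i in \<open>auto simp: A_def\<close>)
    finally show ?thesis by simp
  qed
  moreover have "\<exists>i\<le>n. c $ i \<noteq> 0"
    using c(1,2) by (auto simp: vec_eq_iff less_Suc_eq_le)
  ultimately show ?thesis
    unfolding n_def by (intro exI[of _ "\<lambda>i. c $ i"]) auto
qed

text \<open>
  This is the action of the adjacency matrix on functions on the vertices. It is taken over the
  complex numbers because polynomials have to split into linear factors.
\<close>

definition nbr_sum :: "'v pair_pre_digraph \<Rightarrow> ('v \<Rightarrow> complex) \<Rightarrow> 'v \<Rightarrow> complex" where
  "nbr_sum G f v = (\<Sum>w \<in> {w \<in> pverts G. (v, w) \<in> parcs G}. f w)"

text \<open>
  The \<open>k\<close>-th power of the adjacency matrix applied to the all-ones vector counts the walks of length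
  \<open>k\<close> that start at a given vertex.
\<close>

definition walk_count :: "'v pair_pre_digraph \<Rightarrow> nat \<Rightarrow> 'v \<Rightarrow> complex" where
  "walk_count G k = (nbr_sum G ^^ k) (\<lambda>_. 1)"

text \<open>
  \<open>P(A) j\<close> for the adjacency matrix \<open>A\<close> and the all-ones vector \<open>j\<close>.
\<close>

definition poly_walk :: "'v pair_pre_digraph \<Rightarrow> complex poly \<Rightarrow> 'v \<Rightarrow> complex" where
  "poly_walk G P v = (\<Sum>i \<le> degree P. coeff P i * walk_count G i v)"

definition kills_ones :: "'v pair_pre_digraph \<Rightarrow> complex poly \<Rightarrow> bool" where
  "kills_ones G P \<longleftrightarrow> (\<forall>v \<in> pverts G. poly_walk G P v = 0)"

lemma walk_count_0 [simp]: "walk_count G 0 v = 1"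
  by (simp add: walk_count_def)

lemma walk_count_Suc: "walk_count G (Suc k) = nbr_sum G (walk_count G k)"
  by (simp add: walk_count_def)

lemma poly_walk_eq_sum_atMost:
  assumes "degree P \<le> n"
  shows "poly_walk G P v = (\<Sum>i \<le> n. coeff P i * walk_count G i v)"
  unfolding poly_walk_def by (rule sum.mono_neutral_left) (use assms in \<open>auto simp: coeff_eq_0\<close>)

lemma poly_walk_linear_factor:
  "poly_walk G ([:-c, 1:] * Q) v = nbr_sum G (poly_walk G Q) v - c * poly_walk G Q v"
proof -
  let ?n = "degree Q" and ?P = "[:-c, 1:] * Q"
  have "degree ?P \<le> Suc ?n"
    using degree_mult_le[of "[:-c, 1:]" Q] by simp
  then have "poly_walk G ?P v = (\<Sum>i \<le> Suc ?n. coeff ?P i * walk_count G i v)"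
    by (rule poly_walk_eq_sum_atMost)
  also have "\<dots> = (\<Sum>i \<le> Suc ?n. coeff (pCons 0 Q) i * walk_count G i v)
      - c * (\<Sum>i \<le> Suc ?n. coeff Q i * walk_count G i v)"
    by (simp add: sum_distrib_left sum_subtractf algebra_simps del: sum.atMost_Suc)
  also have "(\<Sum>i \<le> Suc ?n. coeff (pCons 0 Q) i * walk_count G i v)
      = (\<Sum>i \<le> ?n. coeff Q i * walk_count G (Suc i) v)"
    by (subst sum.atMost_Suc_shift) simp
  also have "\<dots> = nbr_sum G (poly_walk G Q) v"
    by (simp add: walk_count_Suc nbr_sum_def poly_walk_def sum_distrib_left sum.swap[of _ "{.._}"])
  also have "(\<Sum>i \<le> Suc ?n. coeff Q i * walk_count G i v) = poly_walk G Q v"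
    by (rule poly_walk_eq_sum_atMost[symmetric]) simp
  finally show ?thesis .
qed

text \<open>
  The matrix and the eigenvalue are real, so the real or the imaginary part of a complex eigenvector
  with nonzero coordinate sum is a real one.
\<close>

lemma main_eigenvalue_iff_complex:
  assumes "finite (pverts G)"
  shows "main_eigenvalue G \<theta> \<longleftrightarrow>
    (\<exists>f. (\<forall>v \<in> pverts G. nbr_sum G f v = of_real \<theta> * f v) \<and> (\<Sum>v \<in> pverts G. f v) \<noteq> 0)"
proof -
  let ?N = "\<lambda>v. {w \<in> pverts G. (v, w) \<in> parcs G}"
  obtain vs where vs: "distinct vs" "set vs = pverts G"
    using finite_distinct_list[OF assms] by blast
  then have "main_eigenvalue G \<theta> \<longleftrightarrow>
      (\<exists>f. (\<forall>v \<in> pverts G. (\<Sum>w \<in> ?N v. f w) = \<theta> * f v) \<and> (\<Sum>v \<in> pverts G. f v) \<noteq> 0)"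
    by (simp add: main_eigenvalue_iff main_eigenvalue_mat_adjacency_mat)
  also have "\<dots> \<longleftrightarrow>
    (\<exists>f. (\<forall>v \<in> pverts G. nbr_sum G f v = of_real \<theta> * f v) \<and> (\<Sum>v \<in> pverts G. f v) \<noteq> 0)"
    (is "?L \<longleftrightarrow> ?R")
  proof
    assume ?L
    then obtain f where f: "\<forall>v \<in> pverts G. (\<Sum>w \<in> ?N v. f w) = \<theta> * f v"
      "(\<Sum>v \<in> pverts G. f v) \<noteq> 0" by blast
    show ?R
      by (rule exI[of _ "\<lambda>v. of_real (f v)"])
        (use f in \<open>simp add: nbr_sum_def flip: of_real_sum of_real_mult\<close>)
  next
    assume ?R
    then obtain f where f: "\<And>v. v \<in> pverts G \<Longrightarrow> nbr_sum G f v = of_real \<theta> * f v"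
      "(\<Sum>v \<in> pverts G. f v) \<noteq> 0" by blast
    have Re: "\<forall>v \<in> pverts G. (\<Sum>w \<in> ?N v. Re (f w)) = \<theta> * Re (f v)"
      using f(1)[THEN arg_cong[of _ _ Re]] by (simp add: nbr_sum_def)
    have Im: "\<forall>v \<in> pverts G. (\<Sum>w \<in> ?N v. Im (f w)) = \<theta> * Im (f v)"
      using f(1)[THEN arg_cong[of _ _ Im]] by (simp add: nbr_sum_def)
    have "(\<Sum>v \<in> pverts G. Re (f v)) \<noteq> 0 \<or> (\<Sum>v \<in> pverts G. Im (f v)) \<noteq> 0"
      using f(2) by (auto simp: complex_eq_iff)
    then show ?L
    proof
      assume "(\<Sum>v \<in> pverts G. Re (f v)) \<noteq> 0"
      with Re show ?L by (intro exI[of _ "\<lambda>v. Re (f v)"]) simp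
    next
      assume "(\<Sum>v \<in> pverts G. Im (f v)) \<noteq> 0"
      with Im show ?L by (intro exI[of _ "\<lambda>v. Im (f v)"]) simp
    qed
  qed
  finally show ?thesis .
qed

lemma exists_kills_ones:
  assumes "finite (pverts G)"
  shows "\<exists>P. P \<noteq> 0 \<and> kills_ones G P"
proof -
  let ?n = "card (pverts G)"
  obtain c where c: "\<exists>i \<le> ?n. c i \<noteq> 0"
      "\<forall>v \<in> pverts G. (\<Sum>i \<le> ?n. c i * walk_count G i v) = 0"
    using exists_linear_relation[OF assms] by meson
  define P where "P = (\<Sum>i\<le>?n. monom (c i) i)"
  have coeff: "coeff P i = (if i \<le> ?n then c i else 0)" for i
    by (simp add: P_def coeff_sum)
  have "P \<noteq> 0" using c(1) coeff by (metis coeff_0)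
  moreover have "degree P \<le> ?n" by (rule degree_le) (simp add: coeff)
  then have "kills_ones G P"
    using c(2) by (auto simp: kills_ones_def poly_walk_eq_sum_atMost coeff)
  ultimately show ?thesis by blast
qed

context pair_graph
begin

lemma nbr_sum_adjoint:
  "(\<Sum>v \<in> pverts G. nbr_sum G f v * cnj (g v)) = (\<Sum>v \<in> pverts G. f v * cnj (nbr_sum G g v))"
proof -
  have fin: "finite (pverts G)" by simp
  have sym: "(v, w) \<in> parcs G \<longleftrightarrow> (w, v) \<in> parcs G" for v w
    by (rule iffI) (auto intro: arcs_symmetric)
  have filter: "(\<Sum>w \<in> {w \<in> pverts G. (v, w) \<in> parcs G}. h w)
      = (\<Sum>w \<in> pverts G. if (v, w) \<in> parcs G then h w else 0)" for h :: "'a \<Rightarrow> complex" and v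
    by (rule sum.inter_filter[OF fin])
  have "(\<Sum>v \<in> pverts G. nbr_sum G f v * cnj (g v))
      = (\<Sum>v \<in> pverts G. \<Sum>w \<in> pverts G. if (v, w) \<in> parcs G then f w * cnj (g v) else 0)"
    by (simp add: nbr_sum_def filter sum_distrib_right if_distrib[of "\<lambda>x. x * _"] cong: if_cong)
  also have "\<dots> = (\<Sum>w \<in> pverts G. \<Sum>v \<in> pverts G. if (v, w) \<in> parcs G then f w * cnj (g v) else 0)"
    by (rule sum.swap)
  also have "\<dots> = (\<Sum>v \<in> pverts G. f v * cnj (nbr_sum G g v))"
    by (simp add: nbr_sum_def filter sum_distrib_left if_distrib[of cnj] sym
        if_distrib[of "\<lambda>x. _ * x"] cong: if_cong)
  finally show ?thesis .
qed

text \<open>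
  Since the adjacency matrix is symmetric, \<open>\<langle>P(A) j, f\<rangle> = \<langle>j, P(A)\<^sup>* f\<rangle>\<close>, and on an eigenvector for a
  real eigenvalue the right side is a multiple of \<open>\<langle>j, f\<rangle>\<close>. This identity links the roots of
  annihilators of \<open>j\<close> with main eigenvalues in both directions.
\<close>

lemma inner_poly_walk_eigenvector:
  assumes "\<And>v. v \<in> pverts G \<Longrightarrow> nbr_sum G f v = of_real \<theta> * f v"
  shows "(\<Sum>v \<in> pverts G. poly_walk G P v * cnj (f v))
    = poly P (of_real \<theta>) * (\<Sum>v \<in> pverts G. cnj (f v))"
proof -
  have power: "(\<Sum>v \<in> pverts G. walk_count G k v * cnj (f v))
      = of_real \<theta> ^ k * (\<Sum>v \<in> pverts G. cnj (f v))" for k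
  proof (induction k)
    case (Suc k)
    have "(\<Sum>v \<in> pverts G. walk_count G (Suc k) v * cnj (f v))
        = (\<Sum>v \<in> pverts G. walk_count G k v * cnj (nbr_sum G f v))"
      unfolding walk_count_Suc by (rule nbr_sum_adjoint)
    also have "\<dots> = of_real \<theta> * (\<Sum>v \<in> pverts G. walk_count G k v * cnj (f v))"
      by (simp add: assms sum_distrib_left mult_ac)
    finally show ?case by (simp add: Suc.IH)
  qed simp
  have "(\<Sum>v \<in> pverts G. poly_walk G P v * cnj (f v))
      = (\<Sum>i \<le> degree P. coeff P i * (\<Sum>v \<in> pverts G. walk_count G i v * cnj (f v)))"
    by (simp add: poly_walk_def sum_distrib_right sum_distrib_left mult_ac sum.swap[of _ "{.._}"])
  also have "\<dots> = (\<Sum>i \<le> degree P. coeff P i * of_real \<theta> ^ i * (\<Sum>v \<in> pverts G. cnj (f v)))"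
    by (simp only: power mult.assoc)
  finally show ?thesis by (simp only: poly_altdef sum_distrib_right)
qed

lemma eigenvalue_real:
  assumes eig: "\<And>v. v \<in> pverts G \<Longrightarrow> nbr_sum G f v = c * f v"
    and "\<exists>v \<in> pverts G. f v \<noteq> 0"
  shows "c \<in> \<real>"
proof -
  have pos: "(\<Sum>v \<in> pverts G. f v * cnj (f v)) \<noteq> 0"
    using assms(2) by (simp add: complex_norm_square[symmetric] sum_nonneg_eq_0_iff flip: of_real_power of_real_sum)
  have "c * (\<Sum>v \<in> pverts G. f v * cnj (f v)) = (\<Sum>v \<in> pverts G. nbr_sum G f v * cnj (f v))"
    by (simp add: eig sum_distrib_left mult_ac)
  also have "\<dots> = (\<Sum>v \<in> pverts G. f v * cnj (nbr_sum G f v))"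
    by (rule nbr_sum_adjoint)
  also have "\<dots> = cnj c * (\<Sum>v \<in> pverts G. f v * cnj (f v))"
    by (simp add: eig sum_distrib_left mult_ac)
  finally have "c = cnj c" using pos by simp
  then show ?thesis by (simp add: Reals_cnj_iff)
qed

lemma main_eigenvalue_root:
  assumes "main_eigenvalue G \<theta>" "kills_ones G P"
  shows "poly P (of_real \<theta>) = 0"
proof -
  obtain f where f: "\<And>v. v \<in> pverts G \<Longrightarrow> nbr_sum G f v = of_real \<theta> * f v"
      "(\<Sum>v \<in> pverts G. f v) \<noteq> 0"
    using assms(1) by (auto simp: main_eigenvalue_iff_complex)
  have "poly P (of_real \<theta>) * (\<Sum>v \<in> pverts G. cnj (f v)) = 0"
    using assms(2) by (simp add: kills_ones_def flip: inner_poly_walk_eigenvector[OF f(1)])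
  moreover have "(\<Sum>v \<in> pverts G. cnj (f v)) \<noteq> 0"
    using f(2) by (simp flip: cnj_sum)
  ultimately show ?thesis by simp
qed

text \<open>
  With \<open>P = (x - c) Q\<close>, the vector \<open>v = Q(A) j\<close> is an eigenvector and
  \<open>\<langle>v, v\<rangle> = Q(c) \<langle>j, v\<rangle>\<close>. The single fact that the left side is nonzero gives both conclusions: \<open>Q(c) \<noteq> 0\<close>
  makes the root simple, and \<open>\<langle>j, v\<rangle> \<noteq> 0\<close> makes the eigenvalue a main one.
\<close>

lemma root_of_minimal_polynomial:
  assumes P: "P \<noteq> 0" "kills_ones G P"
    and minimal: "\<And>Q. Q \<noteq> 0 \<Longrightarrow> kills_ones G Q \<Longrightarrow> degree P \<le> degree Q"
    and root: "poly P c = 0"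
  shows "\<exists>\<theta>. c = of_real \<theta> \<and> main_eigenvalue G \<theta> \<and> order c P = 1"
proof -
  obtain Q where Q: "P = [:-c, 1:] * Q"
    using root by (auto simp: poly_eq_0_iff_dvd)
  with P(1) have Q0: "Q \<noteq> 0" by auto
  then have "degree P = Suc (degree Q)" by (simp add: Q degree_mult_eq del: mult_pCons_left)
  with minimal[OF Q0] have "\<not> kills_ones G Q" by auto
  then have nz: "\<exists>v \<in> pverts G. poly_walk G Q v \<noteq> 0" by (simp add: kills_ones_def)
  have eig: "nbr_sum G (poly_walk G Q) v = c * poly_walk G Q v" if "v \<in> pverts G" for v
    using P(2) that unfolding Q kills_ones_def poly_walk_linear_factor by simp
  obtain \<theta> where \<theta>: "c = of_real \<theta>"
    using eigenvalue_real[OF eig nz] by (auto elim: Reals_cases)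
  have "(\<Sum>v \<in> pverts G. poly_walk G Q v * cnj (poly_walk G Q v)) \<noteq> 0"
    using nz by (simp add: complex_norm_square[symmetric] sum_nonneg_eq_0_iff flip: of_real_power of_real_sum)
  then have *: "poly Q c \<noteq> 0" "(\<Sum>v \<in> pverts G. poly_walk G Q v) \<noteq> 0"
    using inner_poly_walk_eigenvector[of "poly_walk G Q" \<theta> Q] eig by (auto simp: \<theta> simp flip: cnj_sum)
  have "main_eigenvalue G \<theta>"
    using eig *(2) by (auto simp: main_eigenvalue_iff_complex \<theta>)
  moreover have "order c P = 1"
    using *(1) P(1) unfolding Q by (simp add: order_mult order_0I del: mult_pCons_left)
  ultimately show ?thesis using \<theta> by blast
qed

text \<open>
  A complex polynomial has as many roots as its degree, counted with multiplicity. Here all roots are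
  simple, and they are precisely the main eigenvalues.
\<close>

theorem num_main_eigenvalues_eq_minimal_degree:
  assumes P: "P \<noteq> 0" "kills_ones G P"
    and minimal: "\<And>Q. Q \<noteq> 0 \<Longrightarrow> kills_ones G Q \<Longrightarrow> degree P \<le> degree Q"
  shows "num_main_eigenvalues G = degree P"
proof -
  note root = root_of_minimal_polynomial[OF P minimal]
  have "degree P = size (proots P)" by (simp add: size_proots_complex)
  also have "\<dots> = (\<Sum>c | poly P c = 0. order c P)"
    using P(1) by (simp add: size_multiset_overloaded_eq)
  also have "\<dots> = (\<Sum>c | poly P c = 0. 1)"
    by (rule sum.cong) (use root in auto)
  also have "\<dots> = card {c. poly P c = 0}" by simp
  also have "{c. poly P c = 0} = of_real ` {\<theta>. main_eigenvalue G \<theta>}"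
    using root main_eigenvalue_root[OF _ P(2)] by blast
  also have "card \<dots> = num_main_eigenvalues G"
    unfolding num_main_eigenvalues_def by (rule card_image) (simp add: inj_on_def)
  finally show ?thesis by simp
qed

end

corollary num_main_eigenvalues_eq_iff:
  assumes "pair_graph G"
  shows "num_main_eigenvalues G = n \<longleftrightarrow>
    (\<exists>P. P \<noteq> 0 \<and> kills_ones G P \<and> degree P = n) \<and>
    (\<forall>P. P \<noteq> 0 \<longrightarrow> kills_ones G P \<longrightarrow> n \<le> degree P)"
proof -
  interpret pair_graph G by fact
  define is_degree where "is_degree n \<longleftrightarrow> (\<exists>P. P \<noteq> 0 \<and> kills_ones G P \<and> degree P = n)" for n
  define m where "m = (LEAST n. is_degree n)"
  have "is_degree m"
    unfolding m_def by (rule LeastI_ex) (use exists_kills_ones[of G] in \<open>auto simp: is_degree_def\<close>)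
  moreover have least: "m \<le> degree P" if "P \<noteq> 0" "kills_ones G P" for P
    unfolding m_def by (rule Least_le) (use that in \<open>auto simp: is_degree_def\<close>)
  ultimately have "num_main_eigenvalues G = m"
    using num_main_eigenvalues_eq_minimal_degree unfolding is_degree_def by metis
  moreover obtain P where P: "P \<noteq> 0" "kills_ones G P" "degree P = m"
    using \<open>is_degree m\<close> unfolding is_degree_def by blast
  ultimately have num: "num_main_eigenvalues G = degree P" by simp
  show ?thesis
  proof
    assume "num_main_eigenvalues G = n"
    then have "n = degree P" using num by simp
    then show "(\<exists>P. P \<noteq> 0 \<and> kills_ones G P \<and> degree P = n) \<and>
        (\<forall>P. P \<noteq> 0 \<longrightarrow> kills_ones G P \<longrightarrow> n \<le> degree P)"
      using P least by auto
  next
    assume n: "(\<exists>P. P \<noteq> 0 \<and> kills_ones G P \<and> degree P = n) \<and>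
        (\<forall>P. P \<noteq> 0 \<longrightarrow> kills_ones G P \<longrightarrow> n \<le> degree P)"
    then have "n \<le> degree P" using P(1,2) by blast
    moreover have "degree P \<le> n" using n least P(3) by blast
    ultimately show "num_main_eigenvalues G = n" using num by simp
  qed
qed

section \<open>Invariance under isomorphism\<close>

text \<open>
  An isomorphism of digraphs maps vertices and arcs independently. For pair digraphs, whose arcs are
  pairs of vertices, the arc map is determined by the vertex map.
\<close>

lemma digraph_iso_with_projE:
  assumes iso: "digraph_iso (with_proj G) (with_proj H)"
  obtains \<phi> where "inj_on \<phi> (pverts G)" "pverts H = \<phi> ` pverts G"
    "\<And>u v. u \<in> pverts G \<Longrightarrow> v \<in> pverts G \<Longrightarrow> (\<phi> u, \<phi> v) \<in> parcs H \<longleftrightarrow> (u, v) \<in> parcs G"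
proof -
  obtain h where h: "pre_digraph.digraph_isomorphism (with_proj G) h"
    and H: "with_proj H = app_iso h (with_proj G)"
    using iso by (auto simp: digraph_iso_def)
  let ?\<phi> = "iso_verts h"
  have tail: "iso_tail h = fst" and head: "iso_head h = snd"
    using arg_cong[OF H, of tail] arg_cong[OF H, of head] by simp_all
  have verts: "pverts H = ?\<phi> ` pverts G" and arcs: "parcs H = iso_arcs h ` parcs G"
    using arg_cong[OF H, of verts] arg_cong[OF H, of arcs] by simp_all
  have inj: "inj_on ?\<phi> (pverts G)"
    using h by (simp add: pre_digraph.digraph_isomorphism_def)
  have wf: "wf_digraph (with_proj G)"
    using h by (simp add: pre_digraph.digraph_isomorphism_def)
  have ends: "iso_arcs h (u, v) = (?\<phi> u, ?\<phi> v)" if "(u, v) \<in> parcs G" for u v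
    using h that tail head by (force simp: pre_digraph.digraph_isomorphism_def prod_eq_iff)
  have "(?\<phi> u, ?\<phi> v) \<in> parcs H \<longleftrightarrow> (u, v) \<in> parcs G"
    if uv: "u \<in> pverts G" "v \<in> pverts G" for u v
  proof
    assume "(?\<phi> u, ?\<phi> v) \<in> parcs H"
    then obtain x y where xy: "(x, y) \<in> parcs G" "(?\<phi> u, ?\<phi> v) = (?\<phi> x, ?\<phi> y)"
      using arcs ends by auto
    moreover have "x \<in> pverts G" "y \<in> pverts G"
      using wf_digraph.tail_in_verts[OF wf] wf_digraph.head_in_verts[OF wf] xy(1) by force+
    ultimately show "(u, v) \<in> parcs G"
      using inj uv by (auto dest: inj_onD)
  next
    assume "(u, v) \<in> parcs G"
    then show "(?\<phi> u, ?\<phi> v) \<in> parcs H"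
      unfolding arcs using ends by (metis image_eqI)
  qed
  then show ?thesis using that inj verts by blast
qed

text \<open>
  An isomorphism preserves walk counts, and the number of main eigenvalues depends on nothing else.
\<close>

lemma num_main_eigenvalues_cong_iso:
  assumes "pair_graph G" "pair_graph H" "digraph_iso (with_proj G) (with_proj H)"
  shows "num_main_eigenvalues G = num_main_eigenvalues H"
proof -
  obtain \<phi> where inj: "inj_on \<phi> (pverts G)" and verts: "pverts H = \<phi> ` pverts G"
    and arcs: "\<And>u v. u \<in> pverts G \<Longrightarrow> v \<in> pverts G \<Longrightarrow>
      (\<phi> u, \<phi> v) \<in> parcs H \<longleftrightarrow> (u, v) \<in> parcs G"
    using digraph_iso_with_projE[OF assms(3)] by blast
  have walk: "walk_count H k (\<phi> v) = walk_count G k v" if "v \<in> pverts G" for k v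
    using that
  proof (induction k arbitrary: v)
    case (Suc k)
    let ?N = "{w \<in> pverts G. (v, w) \<in> parcs G}"
    have "{w \<in> pverts H. (\<phi> v, w) \<in> parcs H} = \<phi> ` ?N"
      using arcs Suc.prems by (auto simp: verts)
    then have "walk_count H (Suc k) (\<phi> v) = (\<Sum>w \<in> \<phi> ` ?N. walk_count H k w)"
      by (simp add: walk_count_Suc nbr_sum_def)
    also have "\<dots> = (\<Sum>w \<in> ?N. walk_count H k (\<phi> w))"
      by (rule sum.reindex_cong[of \<phi>]) (auto intro: inj_on_subset[OF inj])
    also have "\<dots> = walk_count G (Suc k) v"
      using Suc.IH by (simp add: walk_count_Suc nbr_sum_def)
    finally show ?case .
  qed simp
  have kills: "kills_ones H P \<longleftrightarrow> kills_ones G P" for P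
    by (simp add: kills_ones_def verts poly_walk_def walk)
  show ?thesis
    using num_main_eigenvalues_eq_iff[OF assms(2), THEN iffD1, OF refl]
    unfolding num_main_eigenvalues_eq_iff[OF assms(1)] kills .
qed

lemma digraph_iso_with_proj_refl:
  assumes "pair_graph G"
  shows "digraph_iso (with_proj G) (with_proj G)"
proof -
  interpret pair_graph G by fact
  let ?h = "\<lparr>iso_verts = id, iso_arcs = id, iso_head = snd, iso_tail = fst\<rparr>"
  have "digraph_isomorphism ?h"
    unfolding digraph_isomorphism_def using wf_digraph_axioms by simp
  moreover have "with_proj G = app_iso ?h (with_proj G)"
    by (simp add: app_iso_def with_proj_def)
  ultimately show ?thesis unfolding digraph_iso_def by blast
qed

section \<open>Graphs with exactly three main eigenvalues\<close>

text \<open>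
  The linear relations are the annihilators of the all-ones vector of degree at most 2. A cubic
  annihilator can be scaled to be monic, which gives the first condition.
\<close>

lemma num_main_eigenvalues_eq_3_iff:
  assumes "pair_graph G"
  shows "num_main_eigenvalues G = 3 \<longleftrightarrow>
    (\<exists>\<alpha> \<beta> \<gamma>. \<forall>v \<in> pverts G.
      walk_count G 3 v = \<alpha> * walk_count G 2 v + \<beta> * walk_count G 1 v + \<gamma>) \<and>
    (\<forall>x y z. (\<forall>v \<in> pverts G. x * walk_count G 2 v + y * walk_count G 1 v + z = 0) \<longrightarrow>
      x = 0 \<and> y = 0 \<and> z = 0)"
    (is "_ \<longleftrightarrow> ?cubic \<and> ?indep")
proof -
  have quadratic: "kills_ones G P \<longleftrightarrow> (\<forall>v \<in> pverts G.
      coeff P 2 * walk_count G 2 v + coeff P 1 * walk_count G 1 v + coeff P 0 = 0)"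
    if "degree P \<le> 2" for P
    using that unfolding kills_ones_def
    by (simp add: poly_walk_eq_sum_atMost numeral_2_eq_2 add_ac)
  have cubic: "kills_ones G P \<longleftrightarrow> (\<forall>v \<in> pverts G. coeff P 3 * walk_count G 3 v +
      coeff P 2 * walk_count G 2 v + coeff P 1 * walk_count G 1 v + coeff P 0 = 0)"
    if "degree P \<le> 3" for P
    using that unfolding kills_ones_def
    by (simp add: poly_walk_eq_sum_atMost numeral_2_eq_2 numeral_3_eq_3 add_ac)
  have indep: "?indep \<longleftrightarrow> (\<forall>P. P \<noteq> 0 \<longrightarrow> kills_ones G P \<longrightarrow> 3 \<le> degree P)"
  proof (intro iffI allI impI)
    fix P assume *: ?indep "P \<noteq> 0" "kills_ones G P"
    show "3 \<le> degree P"
    proof (rule ccontr)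
      assume "\<not> 3 \<le> degree P"
      then have deg: "degree P \<le> 2" by simp
      with *(1,3) have "coeff P 2 = 0 \<and> coeff P 1 = 0 \<and> coeff P 0 = 0"
        unfolding quadratic[OF deg] by blast
      moreover have "degree P = 0 \<or> degree P = 1 \<or> degree P = 2" using deg by auto
      ultimately have "lead_coeff P = 0"
        by (elim disjE) (simp_all del: leading_coeff_0_iff)
      with *(2) show False by simp
    qed
  next
    fix x y z
    assume *: "\<forall>P. P \<noteq> 0 \<longrightarrow> kills_ones G P \<longrightarrow> 3 \<le> degree P"
      and "\<forall>v \<in> pverts G. x * walk_count G 2 v + y * walk_count G 1 v + z = 0"
    then have "kills_ones G [:z, y, x:]"
      by (subst quadratic) (simp_all add: numeral_2_eq_2 add_ac)
    moreover have "\<not> 3 \<le> degree [:z, y, x:]" by simp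
    ultimately have "[:z, y, x:] = 0" using * by blast
    then show "x = 0 \<and> y = 0 \<and> z = 0" by simp
  qed
  have "?cubic \<longleftrightarrow> (\<exists>P. P \<noteq> 0 \<and> kills_ones G P \<and> degree P = 3)"
  proof
    assume ?cubic
    then obtain \<alpha> \<beta> \<gamma> where *: "\<forall>v \<in> pverts G.
        walk_count G 3 v = \<alpha> * walk_count G 2 v + \<beta> * walk_count G 1 v + \<gamma>" by blast
    let ?P = "[:-\<gamma>, -\<beta>, -\<alpha>, 1:]"
    have "degree ?P = 3" by simp
    moreover from this have "kills_ones G ?P"
      by (subst cubic) (simp_all add: *[unfolded numeral_2_eq_2 numeral_3_eq_3 One_nat_def] numeral_2_eq_2 numeral_3_eq_3)
    moreover have "?P \<noteq> 0" by simp
    ultimately show "\<exists>P. P \<noteq> 0 \<and> kills_ones G P \<and> degree P = 3" by blast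
  next
    assume "\<exists>P. P \<noteq> 0 \<and> kills_ones G P \<and> degree P = 3"
    then obtain P where P: "P \<noteq> 0" "kills_ones G P" "degree P = 3" by blast
    then have lead: "coeff P 3 \<noteq> 0" by (metis leading_coeff_0_iff)
    let ?c = "\<lambda>i. - coeff P i / coeff P 3"
    have "walk_count G 3 v = ?c 2 * walk_count G 2 v + ?c 1 * walk_count G 1 v + ?c 0"
      if "v \<in> pverts G" for v
    proof -
      have "coeff P 3 * walk_count G 3 v + coeff P 2 * walk_count G 2 v
          + coeff P 1 * walk_count G 1 v + coeff P 0 = 0"
        using P that cubic by auto
      moreover have "coeff P 3 * (walk_count G 3 v
            - (?c 2 * walk_count G 2 v + ?c 1 * walk_count G 1 v + ?c 0))
          = coeff P 3 * walk_count G 3 v + coeff P 2 * walk_count G 2 v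
            + coeff P 1 * walk_count G 1 v + coeff P 0"
        using lead by (simp add: algebra_simps)
      ultimately show ?thesis using lead by simp
    qed
    then show ?cubic by blast
  qed
  with indep show ?thesis by (simp only: num_main_eigenvalues_eq_iff[OF assms])
qed

section \<open>Trees of diameter 5 with a cubic relation are symmetric\<close>

lemma nbr_sum_eq:
  assumes "{w \<in> pverts G. (v, w) \<in> parcs G} = N"
  shows "nbr_sum G f v = sum f N"
  using assms by (simp add: nbr_sum_def)

text \<open>
  Splitting an equality of vertex sets by constructor first keeps the subgoals small enough for
  automation.
\<close>

lemma tree_vertex_set_eqI:
  assumes "U1 \<in> A \<longleftrightarrow> U1 \<in> B" "U2 \<in> A \<longleftrightarrow> U2 \<in> B"
    and "\<And>i. W i \<in> A \<longleftrightarrow> W i \<in> B" "\<And>j. Z j \<in> A \<longleftrightarrow> Z j \<in> B"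
    and "\<And>i k. PendW i k \<in> A \<longleftrightarrow> PendW i k \<in> B" "\<And>j k. PendZ j k \<in> A \<longleftrightarrow> PendZ j k \<in> B"
    and "\<And>k. PendU1 k \<in> A \<longleftrightarrow> PendU1 k \<in> B" "\<And>k. PendU2 k \<in> A \<longleftrightarrow> PendU2 k \<in> B"
  shows "A = B"
proof (rule Set.set_eqI)
  fix x show "x \<in> A \<longleftrightarrow> x \<in> B" using assms by (cases x) simp_all
qed

lemma nbr_sum_diam5_tree:
  fixes p q a b
  defines "T \<equiv> diam5_tree p q a b"
  shows "nbr_sum T f U1 = f U2 + (\<Sum>i < length a. f (W i)) + (\<Sum>k < p. f (PendU1 k))"
    and "nbr_sum T f U2 = f U1 + (\<Sum>j < length b. f (Z j)) + (\<Sum>k < q. f (PendU2 k))"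
    and "i < length a \<Longrightarrow> nbr_sum T f (W i) = f U1 + (\<Sum>k < a ! i. f (PendW i k))"
    and "j < length b \<Longrightarrow> nbr_sum T f (Z j) = f U2 + (\<Sum>k < b ! j. f (PendZ j k))"
    and "i < length a \<Longrightarrow> k < a ! i \<Longrightarrow> nbr_sum T f (PendW i k) = f (W i)"
    and "j < length b \<Longrightarrow> k < b ! j \<Longrightarrow> nbr_sum T f (PendZ j k) = f (Z j)"
    and "k < p \<Longrightarrow> nbr_sum T f (PendU1 k) = f U1"
    and "k < q \<Longrightarrow> nbr_sum T f (PendU2 k) = f U2"
proof -
  note defs = T_def diam5_tree_def tree_vertices_def tree_arcs_def
  show "nbr_sum T f U1 = f U2 + (\<Sum>i < length a. f (W i)) + (\<Sum>k < p. f (PendU1 k))"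
  proof -
    have "nbr_sum T f U1 = sum f (({U2} \<union> W ` {..<length a}) \<union> PendU1 ` {..<p})"
      by (rule nbr_sum_eq, rule tree_vertex_set_eqI) (auto simp: defs)
    also have "\<dots> = f U2 + (\<Sum>i < length a. f (W i)) + (\<Sum>k < p. f (PendU1 k))"
      by (subst sum.union_disjoint; auto simp: sum.reindex inj_on_def image_iff)
    finally show ?thesis .
  qed
  show "nbr_sum T f U2 = f U1 + (\<Sum>j < length b. f (Z j)) + (\<Sum>k < q. f (PendU2 k))"
  proof -
    have "nbr_sum T f U2 = sum f (({U1} \<union> Z ` {..<length b}) \<union> PendU2 ` {..<q})"
      by (rule nbr_sum_eq, rule tree_vertex_set_eqI) (auto simp: defs)
    also have "\<dots> = f U1 + (\<Sum>j < length b. f (Z j)) + (\<Sum>k < q. f (PendU2 k))"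
      by (subst sum.union_disjoint; auto simp: sum.reindex inj_on_def image_iff)
    finally show ?thesis .
  qed
  show "nbr_sum T f (W i) = f U1 + (\<Sum>k < a ! i. f (PendW i k))" if "i < length a"
  proof -
    have "nbr_sum T f (W i) = sum f ({U1} \<union> PendW i ` {..<a ! i})"
      by (rule nbr_sum_eq, rule tree_vertex_set_eqI) (use that in \<open>auto simp: defs\<close>)
    also have "\<dots> = f U1 + (\<Sum>k < a ! i. f (PendW i k))"
      by (subst sum.union_disjoint; auto simp: sum.reindex inj_on_def image_iff)
    finally show ?thesis .
  qed
  show "nbr_sum T f (Z j) = f U2 + (\<Sum>k < b ! j. f (PendZ j k))" if "j < length b"
  proof -
    have "nbr_sum T f (Z j) = sum f ({U2} \<union> PendZ j ` {..<b ! j})"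
      by (rule nbr_sum_eq, rule tree_vertex_set_eqI) (use that in \<open>auto simp: defs\<close>)
    also have "\<dots> = f U2 + (\<Sum>k < b ! j. f (PendZ j k))"
      by (subst sum.union_disjoint; auto simp: sum.reindex inj_on_def image_iff)
    finally show ?thesis .
  qed
  show "nbr_sum T f (PendW i k) = f (W i)" if "i < length a" "k < a ! i"
  proof -
    have "nbr_sum T f (PendW i k) = sum f {W i}"
      by (rule nbr_sum_eq, rule tree_vertex_set_eqI) (use that in \<open>auto simp: defs\<close>)
    then show ?thesis by simp
  qed
  show "nbr_sum T f (PendZ j k) = f (Z j)" if "j < length b" "k < b ! j"
  proof -
    have "nbr_sum T f (PendZ j k) = sum f {Z j}"
      by (rule nbr_sum_eq, rule tree_vertex_set_eqI) (use that in \<open>auto simp: defs\<close>)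
    then show ?thesis by simp
  qed
  show "nbr_sum T f (PendU1 k) = f U1" if "k < p"
  proof -
    have "nbr_sum T f (PendU1 k) = sum f {U1}"
      by (rule nbr_sum_eq, rule tree_vertex_set_eqI) (use that in \<open>auto simp: defs\<close>)
    then show ?thesis by simp
  qed
  show "nbr_sum T f (PendU2 k) = f U2" if "k < q"
  proof -
    have "nbr_sum T f (PendU2 k) = sum f {U2}"
      by (rule nbr_sum_eq, rule tree_vertex_set_eqI) (use that in \<open>auto simp: defs\<close>)
    then show ?thesis by simp
  qed
qed

lemma walk_count_numeral:
  "walk_count G (Suc 0) = nbr_sum G (\<lambda>_. 1)"
  "walk_count G 2 = nbr_sum G (nbr_sum G (\<lambda>_. 1))"
  "walk_count G 3 = nbr_sum G (nbr_sum G (nbr_sum G (\<lambda>_. 1)))"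
  by (simp_all add: walk_count_def numeral_2_eq_2 numeral_3_eq_3)

text \<open>
  Subtracting the equation at a pendant neighbour of \<open>u\<^sub>1\<close> from the one at \<open>w\<^sub>i\<close> leaves
  \<open>a\<^sub>i (a\<^sub>i + 1) = (\<alpha> + \<beta>) a\<^sub>i\<close>, hence \<open>a\<^sub>i = \<alpha> + \<beta> - 1\<close>.
  The same value comes out for the \<open>b\<^sub>j\<close>. The pendant neighbours of \<open>w\<^sub>i\<close> and \<open>z\<^sub>j\<close> then show that \<open>u\<^sub>1\<close> and
  \<open>u\<^sub>2\<close> have equal degrees, and the pendant neighbours of \<open>u\<^sub>1\<close> and \<open>u\<^sub>2\<close> that these two vertices start
  equally many walks of length 2. Together this gives \<open>r = s\<close> and \<open>p = q\<close>.
\<close>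

lemma diam5_tree_cubic_imp_symmetric:
  fixes \<alpha> \<beta> \<gamma> :: complex
  assumes "p \<ge> 1" "q \<ge> 1" "length a \<ge> 1" "length b \<ge> 1"
    and pos_a: "\<forall>x \<in> set a. 1 \<le> x" and pos_b: "\<forall>x \<in> set b. 1 \<le> x"
    and cubic: "\<forall>v \<in> pverts (diam5_tree p q a b). walk_count (diam5_tree p q a b) 3 v =
      \<alpha> * walk_count (diam5_tree p q a b) 2 v + \<beta> * walk_count (diam5_tree p q a b) 1 v + \<gamma>"
  obtains c where "c \<ge> 1" "diam5_tree p q a b = sym_tree p (length a) c"
proof -
  define r s where "r = length a" and "s = length b"
  let ?T = "diam5_tree p q a b"
  have eq: "walk_count ?T 3 v = \<alpha> * walk_count ?T 2 v + \<beta> * walk_count ?T 1 v + \<gamma>"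
    if "v \<in> tree_vertices p q a b" for v
    using cubic that by (simp add: diam5_tree_def)
  note vals = walk_count_numeral nbr_sum_diam5_tree sum.distrib sum_distrib_left
  \<comment> \<open>The numbers of walks of length 1 and 2 that start at \<open>u\<^sub>1\<close> and at \<open>u\<^sub>2\<close>.\<close>
  define d1 d2 where "d1 = r + p + 1" and "d2 = s + q + 1"
  define e1 e2 where "e1 = sum_list a + r + p + d2" and "e2 = sum_list b + s + q + d1"
  have sum_a: "(\<Sum>i < r. complex_of_nat (a ! i)) = of_nat (sum_list a)"
    and sum_b: "(\<Sum>i < s. complex_of_nat (b ! i)) = of_nat (sum_list b)"
    by (simp_all add: r_def s_def sum_list_sum_nth atLeast0LessThan)
  have walk_U1: "walk_count ?T 1 U1 = of_nat d1" "walk_count ?T 2 U1 = of_nat e1"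
    by (simp_all add: vals d1_def d2_def e1_def sum_a[symmetric] r_def s_def)
  have walk_U2: "walk_count ?T 1 U2 = of_nat d2" "walk_count ?T 2 U2 = of_nat e2"
    by (simp_all add: vals d1_def d2_def e2_def sum_b[symmetric] r_def s_def)
  have pend_u1: "of_nat e1 = \<alpha> * of_nat d1 + \<beta> + \<gamma>"
    using eq[of "PendU1 0"] assms(1) walk_U1
    by (simp add: walk_count_numeral nbr_sum_diam5_tree(7) tree_vertices_def)
  have pend_u2: "of_nat e2 = \<alpha> * of_nat d2 + \<beta> + \<gamma>"
    using eq[of "PendU2 0"] assms(2) walk_U2
    by (simp add: walk_count_numeral nbr_sum_diam5_tree(8) tree_vertices_def)
  have w: "of_nat e1 + of_nat (a ! i) * (of_nat (a ! i) + 1)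
        = \<alpha> * (of_nat d1 + of_nat (a ! i)) + \<beta> * (of_nat (a ! i) + 1) + \<gamma>"
      "of_nat d1 + of_nat (a ! i) = \<alpha> * (of_nat (a ! i) + 1) + \<beta> + \<gamma>"
      "a ! i \<ge> 1" if "i < r" for i
  proof -
    have i: "i < length a" using that by (simp add: r_def)
    then show ai: "a ! i \<ge> 1" using pos_a by simp
    show "of_nat e1 + of_nat (a ! i) * (of_nat (a ! i) + 1)
        = \<alpha> * (of_nat d1 + of_nat (a ! i)) + \<beta> * (of_nat (a ! i) + 1) + \<gamma>"
      using eq[of "W i"] i walk_U1
      by (simp add: walk_count_numeral nbr_sum_diam5_tree(3,5) tree_vertices_def add_ac)
    show "of_nat d1 + of_nat (a ! i) = \<alpha> * (of_nat (a ! i) + 1) + \<beta> + \<gamma>"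
      using eq[of "PendW i 0"] i ai walk_U1
      by (simp add: walk_count_numeral nbr_sum_diam5_tree(3,5) tree_vertices_def add_ac)
  qed
  have z: "of_nat e2 + of_nat (b ! j) * (of_nat (b ! j) + 1)
        = \<alpha> * (of_nat d2 + of_nat (b ! j)) + \<beta> * (of_nat (b ! j) + 1) + \<gamma>"
      "of_nat d2 + of_nat (b ! j) = \<alpha> * (of_nat (b ! j) + 1) + \<beta> + \<gamma>"
      "b ! j \<ge> 1" if "j < s" for j
  proof -
    have j: "j < length b" using that by (simp add: s_def)
    then show bj: "b ! j \<ge> 1" using pos_b by simp
    show "of_nat e2 + of_nat (b ! j) * (of_nat (b ! j) + 1)
        = \<alpha> * (of_nat d2 + of_nat (b ! j)) + \<beta> * (of_nat (b ! j) + 1) + \<gamma>"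
      using eq[of "Z j"] j walk_U2
      by (simp add: walk_count_numeral nbr_sum_diam5_tree(4,6) tree_vertices_def add_ac)
    show "of_nat d2 + of_nat (b ! j) = \<alpha> * (of_nat (b ! j) + 1) + \<beta> + \<gamma>"
      using eq[of "PendZ j 0"] j bj walk_U2
      by (simp add: walk_count_numeral nbr_sum_diam5_tree(4,6) tree_vertices_def add_ac)
  qed
  have a_val: "of_nat (a ! i) = \<alpha> + \<beta> - 1" if "i < r" for i
  proof -
    have "of_nat (a ! i) * (of_nat (a ! i) - (\<alpha> + \<beta> - 1)) = 0"
      using w(1)[OF that] pend_u1 by (simp add: algebra_simps)
    then show ?thesis using w(3)[OF that] by simp
  qed
  have b_val: "of_nat (b ! j) = \<alpha> + \<beta> - 1" if "j < s" for j
  proof -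
    have "of_nat (b ! j) * (of_nat (b ! j) - (\<alpha> + \<beta> - 1)) = 0"
      using z(1)[OF that] pend_u2 by (simp add: algebra_simps)
    then show ?thesis using z(3)[OF that] by simp
  qed
  define c where "c = a ! 0"
  have rs: "r \<ge> 1" "s \<ge> 1" using assms by (simp_all add: r_def s_def)
  then have c: "of_nat c = \<alpha> + \<beta> - 1" "c \<ge> 1"
    using a_val[of 0] w(3)[of 0] by (simp_all add: c_def)
  have a_c: "a ! i = c" if "i < r" for i
    using a_val[OF that] c by (metis of_nat_eq_iff)
  have b_c: "b ! j = c" if "j < s" for j
    using b_val[OF that] c by (metis of_nat_eq_iff)
  have a: "a = replicate r c" and b: "b = replicate s c"
    using a_c b_c by (auto simp: r_def s_def intro!: nth_equalityI)
  have "of_nat d1 + of_nat c = \<alpha> * (of_nat c + 1) + \<beta> + \<gamma>"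
    and "of_nat d2 + of_nat c = \<alpha> * (of_nat c + 1) + \<beta> + \<gamma>"
    using w(2)[of 0] z(2)[of 0] a_c b_c rs by simp_all
  then have "complex_of_nat d1 = of_nat d2" by (metis add_right_cancel)
  then have d: "d1 = d2" by (simp only: of_nat_eq_iff)
  with pend_u1 pend_u2 have e: "e1 = e2" by (metis of_nat_eq_iff)
  have "sum_list a = r * c" "sum_list b = s * c"
    by (simp_all add: a b sum_list_replicate)
  then have "r * c = s * c" and rp: "r + p = s + q"
    using d e unfolding d1_def d2_def e1_def e2_def by linarith+
  with c(2) rp have "r = s" "p = q" by auto
  then have "diam5_tree p q a b = sym_tree p (length a) c"
    unfolding sym_tree_def r_def[symmetric] using a b by simp
  with c(2) that show ?thesis by blast
qed

section \<open>Symmetric trees\<close>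

text \<open>
  The vertices of a symmetric tree fall into four classes on which walk counts are constant:
  the centres, their inner neighbours, the pendant neighbours of the latter, and those of the centres.
  Any condition on the first three walk counts is therefore checked four times.
\<close>

lemma all_walk_counts_sym_tree:
  fixes p r c :: nat
  assumes "p \<ge> 1" "r \<ge> 1" "c \<ge> 1"
  defines "T \<equiv> sym_tree p r c" and "m \<equiv> complex_of_nat (r + p)"
    and "C \<equiv> complex_of_nat c" and "R \<equiv> complex_of_nat r"
  shows "(\<forall>v \<in> pverts T. \<Phi> (walk_count T 1 v) (walk_count T 2 v) (walk_count T 3 v)) \<longleftrightarrow>
    \<Phi> (m + 1) (R * C + 2 * m + 1) (2 * R * C + m * (m + 3) + 1) \<and>
    \<Phi> (C + 1) (m + C + 1) (R * C + 2 * m + 1 + C * (C + 1)) \<and>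
    \<Phi> 1 (C + 1) (m + C + 1) \<and>
    \<Phi> 1 (m + 1) (R * C + 2 * m + 1)"
    (is "?L \<longleftrightarrow> ?U \<and> ?W \<and> ?PW \<and> ?PU")
proof -
  note T = T_def sym_tree_def
  note param_defs = m_def C_def R_def
  have verts: "pverts T = {U1, U2} \<union> W ` {..<r} \<union> Z ` {..<r} \<union> {PendW i k | i k. i < r \<and> k < c}
      \<union> {PendZ i k | i k. i < r \<and> k < c} \<union> PendU1 ` {..<p} \<union> PendU2 ` {..<p}"
    by (auto simp: T diam5_tree_def tree_vertices_def)
  note vals = T walk_count_numeral nbr_sum_diam5_tree
  have U: "walk_count T 1 v = m + 1" "walk_count T 2 v = R * C + 2 * m + 1"
      "walk_count T 3 v = 2 * R * C + m * (m + 3) + 1" if "v \<in> {U1, U2}" for v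
    using that by (auto simp: vals param_defs algebra_simps cong: sum.cong_simp)
  have W: "walk_count T 1 v = C + 1" "walk_count T 2 v = m + C + 1"
      "walk_count T 3 v = R * C + 2 * m + 1 + C * (C + 1)" if "v \<in> W ` {..<r} \<union> Z ` {..<r}" for v
    using that by (auto simp: vals param_defs algebra_simps cong: sum.cong_simp)
  have PW: "walk_count T 1 v = 1" "walk_count T 2 v = C + 1" "walk_count T 3 v = m + C + 1"
    if "v \<in> {PendW i k | i k. i < r \<and> k < c} \<union> {PendZ i k | i k. i < r \<and> k < c}" for v
    using that by (auto simp: vals param_defs algebra_simps cong: sum.cong_simp)
  have PU: "walk_count T 1 v = 1" "walk_count T 2 v = m + 1" "walk_count T 3 v = R * C + 2 * m + 1"
    if "v \<in> PendU1 ` {..<p} \<union> PendU2 ` {..<p}" for v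
    using that by (auto simp: vals param_defs algebra_simps cong: sum.cong_simp)
  show ?thesis
  proof
    assume L: ?L
    have "U1 \<in> pverts T" "W 0 \<in> pverts T" "PendW 0 0 \<in> pverts T" "PendU1 0 \<in> pverts T"
      using assms(1-3) by (auto simp: verts)
    with L have "\<Phi> (walk_count T 1 v) (walk_count T 2 v) (walk_count T 3 v)"
      if "v \<in> {U1, W 0, PendW 0 0, PendU1 0}" for v
      using that by auto
    from this[of U1] this[of "W 0"] this[of "PendW 0 0"] this[of "PendU1 0"]
    show "?U \<and> ?W \<and> ?PW \<and> ?PU"
      using U[of U1] W[of "W 0"] PW[of "PendW 0 0"] PU[of "PendU1 0"] assms(1-3) by auto
  next
    assume R: "?U \<and> ?W \<and> ?PW \<and> ?PU"
    show ?L
    proof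
      fix v assume "v \<in> pverts T"
      then consider "v \<in> {U1, U2}" | "v \<in> W ` {..<r} \<union> Z ` {..<r}"
        | "v \<in> {PendW i k | i k. i < r \<and> k < c} \<union> {PendZ i k | i k. i < r \<and> k < c}"
        | "v \<in> PendU1 ` {..<p} \<union> PendU2 ` {..<p}"
        unfolding verts by blast
      then show "\<Phi> (walk_count T 1 v) (walk_count T 2 v) (walk_count T 3 v)"
      proof cases
        case 1
        with R show ?thesis by (simp only: U)
      next
        case 2
        with R show ?thesis by (simp only: W)
      next
        case 3
        with R show ?thesis by (simp only: PW)
      next
        case 4
        with R show ?thesis by (simp only: PU)
      qed
    qed
  qed
qed

text \<open>
  Here \<open>m = r + p\<close>. The two kinds of pendant vertices give \<open>x = 0\<close> or \<open>c = m\<close>. In the second case the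
  remaining equations leave \<open>r c x = 0\<close>. So a symmetric tree has at least three main eigenvalues.
\<close>

lemma sym_tree_walk_relation_trivial:
  assumes "p \<ge> 1" "r \<ge> 1" "c \<ge> 1"
    and rel: "\<forall>v \<in> pverts (sym_tree p r c).
      x * walk_count (sym_tree p r c) 2 v + y * walk_count (sym_tree p r c) 1 v + z = 0"
  shows "x = 0 \<and> y = 0 \<and> z = 0"
proof -
  define m C R where "m = complex_of_nat (r + p)" and "C = complex_of_nat c"
    and "R = complex_of_nat r"
  have nz: "m \<noteq> 0" "C \<noteq> 0" "R \<noteq> 0"
    using assms by (simp_all add: m_def C_def R_def del: of_nat_add)
  have rels: "x * (R * C + 2 * m + 1) + y * (m + 1) + z = 0" "x * (m + C + 1) + y * (C + 1) + z = 0"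
    "x * (C + 1) + y + z = 0" "x * (m + 1) + y + z = 0"
    using rel all_walk_counts_sym_tree[OF assms(1-3), of "\<lambda>w1 w2 w3. x * w2 + y * w1 + z = 0"]
    by (simp_all add: m_def C_def R_def)
  have eqs: "R * C * x + m * (x + y) = 0" "m * x + C * y = 0" "(C - m) * x = 0" "z = - x * (C + 1) - y"
    using rels by Groebner_Basis.algebra+
  have "x = 0"
  proof (rule ccontr)
    assume "x \<noteq> 0"
    with eqs(3) have "C = m" by simp
    with eqs(2) have "m * (x + y) = 0" by Groebner_Basis.algebra
    with eqs(1) nz \<open>x \<noteq> 0\<close> show False by simp
  qed
  with eqs nz show ?thesis by simp
qed

text \<open>
  Of the four equations, three determine \<open>\<beta>\<close> and \<open>\<gamma>\<close> from \<open>t = \<alpha> - 1\<close> and yield \<open>r c = t (m - c)\<close>, where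
  \<open>m = r + p\<close>. The equation at the centres becomes \<open>(m - c) (m - t\<^sup>2) = 0\<close>, and \<open>m \<noteq> c\<close> because \<open>r c\<close>
  is nonzero. Then \<open>r c = t (t\<^sup>2 - c)\<close>, which is the second equation on the right.
\<close>

lemma sym_tree_cubic_iff:
  assumes "p \<ge> 1" "r \<ge> 1" "c \<ge> 1"
  defines "T \<equiv> sym_tree p r c"
  shows "(\<exists>\<alpha> \<beta> \<gamma>. \<forall>v \<in> pverts T.
      walk_count T 3 v = \<alpha> * walk_count T 2 v + \<beta> * walk_count T 1 v + \<gamma>) \<longleftrightarrow>
    (\<exists>t :: int. t\<^sup>2 = int (r + p) \<and> int c * (int r + t) = t ^ 3)"
    (is "?L \<longleftrightarrow> ?R")
proof -
  define m C R where "m = complex_of_nat (r + p)" and "C = complex_of_nat c"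
    and "R = complex_of_nat r"
  have nz: "m \<noteq> 0" "C \<noteq> 0" "R \<noteq> 0"
    using assms by (simp_all add: m_def C_def R_def del: of_nat_add)
  have cubic: "(\<forall>v \<in> pverts T.
      walk_count T 3 v = \<alpha> * walk_count T 2 v + \<beta> * walk_count T 1 v + \<gamma>) \<longleftrightarrow>
      2 * R * C + m * (m + 3) + 1 = \<alpha> * (R * C + 2 * m + 1) + \<beta> * (m + 1) + \<gamma> \<and>
      R * C + 2 * m + 1 + C * (C + 1) = \<alpha> * (m + C + 1) + \<beta> * (C + 1) + \<gamma> \<and>
      m + C + 1 = \<alpha> * (C + 1) + \<beta> + \<gamma> \<and>
      R * C + 2 * m + 1 = \<alpha> * (m + 1) + \<beta> + \<gamma>" for \<alpha> \<beta> \<gamma>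
    using all_walk_counts_sym_tree[OF assms(1-3), of "\<lambda>w1 w2 w3. w3 = \<alpha> * w2 + \<beta> * w1 + \<gamma>"]
    by (simp add: m_def C_def R_def T_def)
  show ?thesis
  proof
    assume ?L
    then obtain \<alpha> \<beta> \<gamma> where eqs:
      "2 * R * C + m * (m + 3) + 1 = \<alpha> * (R * C + 2 * m + 1) + \<beta> * (m + 1) + \<gamma>"
      "R * C + 2 * m + 1 + C * (C + 1) = \<alpha> * (m + C + 1) + \<beta> * (C + 1) + \<gamma>"
      "m + C + 1 = \<alpha> * (C + 1) + \<beta> + \<gamma>"
      "R * C + 2 * m + 1 = \<alpha> * (m + 1) + \<beta> + \<gamma>"
      unfolding cubic by blast
    define t where "t = \<alpha> - 1"
    have "C * (C + 1 - \<alpha> - \<beta>) = 0" using eqs(2,4) by Groebner_Basis.algebra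
    then have "C + 1 - \<alpha> - \<beta> = 0" using nz(2) by (metis mult_eq_0_iff)
    then have \<beta>: "\<beta> = C - t" using t_def by Groebner_Basis.algebra
    have \<gamma>: "\<gamma> = m - (t + 1) * C" using eqs(3) \<beta> t_def by Groebner_Basis.algebra
    have t1: "R * C = t * (m - C)" using eqs(4) \<beta> \<gamma> t_def by Groebner_Basis.algebra
    with nz have neq: "m - C \<noteq> 0" by auto
    have "(m - C) * (m - t\<^sup>2) = 0" using eqs(1) \<beta> \<gamma> t1 t_def by Groebner_Basis.algebra
    with neq have t2: "m = t\<^sup>2" by simp
    \<comment> \<open>So far \<open>t\<close> is complex. Since \<open>(r c)\<^sup>2 = m (m - c)\<^sup>2\<close> holds in the integers, \<open>m - c\<close> divides \<open>r c\<close>,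
      and the quotient \<open>k\<close> is the integral value of \<open>t\<close>.\<close>
    define m' c' r' where "m' = int (r + p)" and "c' = int c" and "r' = int r"
    have "(R * C)\<^sup>2 = m * (m - C)\<^sup>2" using t1 t2 by Groebner_Basis.algebra
    then have "complex_of_int ((r' * c')\<^sup>2) = of_int (m' * (m' - c')\<^sup>2)"
      by (simp add: m_def C_def R_def m'_def c'_def r'_def)
    then have sq: "(r' * c')\<^sup>2 = m' * (m' - c')\<^sup>2" by (simp only: of_int_eq_iff)
    then have "(m' - c')\<^sup>2 dvd (r' * c')\<^sup>2" by simp
    then have "m' - c' dvd r' * c'" by simp
    then obtain k where k: "r' * c' = (m' - c') * k" by blast
    have neq': "m' - c' \<noteq> 0"
    proof
      assume "m' - c' = 0"
      then have "r + p = c" by (simp add: m'_def c'_def flip: of_nat_add)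
      then show False using neq by (simp add: m_def C_def)
    qed
    have "(m' - c')\<^sup>2 * (k\<^sup>2 - m') = 0" using sq k by Groebner_Basis.algebra
    with neq' have "k\<^sup>2 = m'" by simp
    moreover have "c' * (r' + k) = m' * k" using k by (simp add: algebra_simps)
    ultimately have "k\<^sup>2 = m'" "c' * (r' + k) = k ^ 3"
      by (simp_all add: power2_eq_square power3_eq_cube)
    then show ?R unfolding m'_def c'_def r'_def by blast
  next
    assume ?R
    then obtain k :: int where k: "k\<^sup>2 = int (r + p)" "int c * (int r + k) = k ^ 3" by blast
    define t where "t = complex_of_int k"
    have t: "t\<^sup>2 = m" "C * (R + t) = t ^ 3"
      using k[THEN arg_cong, of complex_of_int] by (simp_all add: t_def m_def C_def R_def)
    have RC: "R * C = t * (m - C)" using t by (simp add: algebra_simps power2_eq_square power3_eq_cube)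
    have tRC: "t * (R * C) = m * (m - C)"
      unfolding RC using t(1) by (simp add: power2_eq_square flip: mult.assoc)
    show ?L
      unfolding cubic
    proof (intro exI conjI)
      let ?\<alpha> = "t + 1" and ?\<beta> = "C - t" and ?\<gamma> = "m - (t + 1) * C"
      show "2 * R * C + m * (m + 3) + 1 = ?\<alpha> * (R * C + 2 * m + 1) + ?\<beta> * (m + 1) + ?\<gamma>"
        using RC tRC by Groebner_Basis.algebra
      show "R * C + 2 * m + 1 + C * (C + 1) = ?\<alpha> * (m + C + 1) + ?\<beta> * (C + 1) + ?\<gamma>"
        using RC tRC by Groebner_Basis.algebra
      show "m + C + 1 = ?\<alpha> * (C + 1) + ?\<beta> + ?\<gamma>" by Groebner_Basis.algebra
      show "R * C + 2 * m + 1 = ?\<alpha> * (m + 1) + ?\<beta> + ?\<gamma>" using RC tRC by Groebner_Basis.algebra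
    qed
  qed
qed

lemma num_main_eigenvalues_sym_tree_eq_3_iff:
  assumes "p \<ge> 1" "r \<ge> 1" "c \<ge> 1"
  shows "num_main_eigenvalues (sym_tree p r c) = 3 \<longleftrightarrow>
    (\<exists>t :: int. t\<^sup>2 = int (r + p) \<and> int c * (int r + t) = t ^ 3)"
proof -
  let ?T = "sym_tree p r c"
  have graph: "pair_graph ?T"
    unfolding sym_tree_def by (rule pair_graph_diam5_tree)
  have indep: "\<forall>x y z. (\<forall>v \<in> pverts ?T. x * walk_count ?T 2 v + y * walk_count ?T 1 v + z = 0) \<longrightarrow>
      x = 0 \<and> y = 0 \<and> z = 0"
    by (intro allI impI) (rule sym_tree_walk_relation_trivial[OF assms])
  show ?thesis
    unfolding num_main_eigenvalues_eq_3_iff[OF graph] sym_tree_cubic_iff[OF assms]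
    by (rule iffI, erule conjunct1, rule conjI[OF _ indep])
qed

text \<open>
  The parameters correspond by \<open>t = \<delta> \<kappa>\<close> and \<open>\<eta> = \<kappa> + \<delta> r\<close>: the sign \<open>\<delta>\<close> and the modulus \<open>\<kappa>\<close> of \<open>t\<close>
  satisfy \<open>c (\<kappa> + \<delta> r) = \<kappa>\<^sup>3\<close>.
\<close>

lemma three_main_family_eq:
  "three_main_family = {sym_tree p r c | p r c. p \<ge> 1 \<and> r \<ge> 1 \<and> c \<ge> 1 \<and>
    (\<exists>t :: int. t\<^sup>2 = int (r + p) \<and> int c * (int r + t) = t ^ 3)}"
proof (intro equalityI subsetI)
  fix T assume "T \<in> three_main_family"
  then obtain \<kappa> \<eta> \<delta> :: int where *: "\<kappa> \<ge> 2" "\<eta> \<ge> 1" "\<delta> \<in> {1, -1}" "\<eta> dvd \<kappa> ^ 3"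
      "1 \<le> \<delta> * (\<eta> - \<kappa>)" "\<delta> * (\<eta> - \<kappa>) \<le> \<kappa>\<^sup>2 - 1"
    and T: "T = sym_tree (nat (\<kappa>\<^sup>2 - \<delta> * (\<eta> - \<kappa>))) (nat (\<delta> * (\<eta> - \<kappa>))) (nat (\<kappa> ^ 3 div \<eta>))"
    unfolding three_main_family_def by blast
  obtain c where c: "\<kappa> ^ 3 = \<eta> * c" using *(4) by blast
  have "\<eta> * c > 0" using *(1) by (simp flip: c)
  then have c1: "c \<ge> 1" using *(2) by (simp add: zero_less_mult_iff)
  have div: "\<kappa> ^ 3 div \<eta> = c" using c *(2) by simp
  have \<delta>: "\<delta> * \<delta> = 1" using *(3) by auto
  have "c * (\<delta> * (\<eta> - \<kappa>) + \<delta> * \<kappa>) = (\<delta> * \<kappa>) ^ 3"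
    using c \<delta> by Groebner_Basis.algebra
  moreover have "(\<delta> * \<kappa>)\<^sup>2 = \<kappa>\<^sup>2" using \<delta> by Groebner_Basis.algebra
  ultimately have "\<exists>t :: int. t\<^sup>2 = int (nat (\<delta> * (\<eta> - \<kappa>)) + nat (\<kappa>\<^sup>2 - \<delta> * (\<eta> - \<kappa>))) \<and>
      int (nat c) * (int (nat (\<delta> * (\<eta> - \<kappa>))) + t) = t ^ 3"
    using *(5,6) c1 by (intro exI[of _ "\<delta> * \<kappa>"]) simp
  moreover have "nat (\<kappa>\<^sup>2 - \<delta> * (\<eta> - \<kappa>)) \<ge> 1" "nat (\<delta> * (\<eta> - \<kappa>)) \<ge> 1" "nat c \<ge> 1"
    using *(5,6) c1 by simp_all
  ultimately show "T \<in> {sym_tree p r c | p r c. p \<ge> 1 \<and> r \<ge> 1 \<and> c \<ge> 1 \<and>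
      (\<exists>t :: int. t\<^sup>2 = int (r + p) \<and> int c * (int r + t) = t ^ 3)}"
    unfolding T div by blast
next
  fix T assume "T \<in> {sym_tree p r c | p r c. p \<ge> 1 \<and> r \<ge> 1 \<and> c \<ge> 1 \<and>
      (\<exists>t :: int. t\<^sup>2 = int (r + p) \<and> int c * (int r + t) = t ^ 3)}"
  then obtain p r c and t :: int where T: "T = sym_tree p r c"
    and pos: "p \<ge> 1" "r \<ge> 1" "c \<ge> 1"
    and t: "t\<^sup>2 = int (r + p)" "int c * (int r + t) = t ^ 3" by blast
  define \<delta> \<kappa> \<eta> where "\<delta> = sgn t" and "\<kappa> = \<bar>t\<bar>" and "\<eta> = \<kappa> + \<delta> * int r"
  have "t \<noteq> 0" using t(1) pos by auto
  then have \<delta>: "\<delta> \<in> {1, -1}" "\<delta> * \<delta> = 1" by (auto simp: \<delta>_def sgn_if)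
  have t_eq: "t = \<delta> * \<kappa>" by (simp add: \<delta>_def \<kappa>_def sgn_mult_abs)
  have r: "\<delta> * (\<eta> - \<kappa>) = int r" using \<delta>(2) \<eta>_def by Groebner_Basis.algebra
  have \<kappa>2: "\<kappa>\<^sup>2 = int r + int p" using t(1) by (simp add: \<kappa>_def)
  have \<kappa>: "\<kappa> \<ge> 2"
  proof (rule ccontr)
    assume "\<not> \<kappa> \<ge> 2"
    then have "\<kappa> \<in> {0, 1}" by (auto simp: \<kappa>_def)
    with \<kappa>2 pos show False by auto
  qed
  have c: "int c * \<eta> = \<kappa> ^ 3" using t(2) t_eq \<delta>(2) \<eta>_def by Groebner_Basis.algebra
  moreover have "\<kappa> ^ 3 > 0" using \<kappa> by simp
  ultimately have "int c * \<eta> > 0" by simp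
  then have \<eta>: "\<eta> \<ge> 1" using pos(3) by (simp add: zero_less_mult_iff)
  have "\<kappa> ^ 3 div \<eta> = int c" using \<eta> by (simp flip: c)
  then have "T = sym_tree (nat (\<kappa>\<^sup>2 - \<delta> * (\<eta> - \<kappa>))) (nat (\<delta> * (\<eta> - \<kappa>))) (nat (\<kappa> ^ 3 div \<eta>))"
    by (simp add: T r \<kappa>2)
  moreover have "\<eta> dvd \<kappa> ^ 3" by (simp flip: c)
  moreover have "1 \<le> \<delta> * (\<eta> - \<kappa>)" "\<delta> * (\<eta> - \<kappa>) \<le> \<kappa>\<^sup>2 - 1"
    using pos by (simp_all add: r \<kappa>2)
  ultimately show "T \<in> three_main_family"
    unfolding three_main_family_def using \<kappa> \<eta> \<delta>(1) by blast
qed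

theorem theorem3p7:
  fixes p q r s :: nat and a b :: "nat list"
  assumes "p \<ge> 1" "q \<ge> 1" "r \<ge> 1" "s \<ge> 1"
    and "length a = r" "sorted a" "\<forall>x \<in> set a. 1 \<le> x"
    and "length b = s" "sorted b" "\<forall>x \<in> set b. 1 \<le> x"
  shows "num_main_eigenvalues (diam5_tree p q a b) = 3 \<longleftrightarrow>
    (\<exists>T \<in> three_main_family. digraph_iso (with_proj (diam5_tree p q a b)) (with_proj T))"
proof
  let ?T = "diam5_tree p q a b"
  assume three: "num_main_eigenvalues ?T = 3"
  then obtain \<alpha> \<beta> \<gamma> where "\<forall>v \<in> pverts ?T.
      walk_count ?T 3 v = \<alpha> * walk_count ?T 2 v + \<beta> * walk_count ?T 1 v + \<gamma>"
    using num_main_eigenvalues_eq_3_iff[OF pair_graph_diam5_tree] by blast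
  then obtain c where c: "c \<ge> 1" "?T = sym_tree p r c"
    using diam5_tree_cubic_imp_symmetric[of p q a b] assms by blast
  then have "?T \<in> three_main_family"
    using three assms num_main_eigenvalues_sym_tree_eq_3_iff[of p r c]
    unfolding three_main_family_eq by auto
  then show "\<exists>T \<in> three_main_family. digraph_iso (with_proj ?T) (with_proj T)"
    using digraph_iso_with_proj_refl[OF pair_graph_diam5_tree] by blast
next
  let ?T = "diam5_tree p q a b"
  assume "\<exists>T \<in> three_main_family. digraph_iso (with_proj ?T) (with_proj T)"
  then obtain p' r' c where pos: "p' \<ge> 1" "r' \<ge> 1" "c \<ge> 1"
    and "\<exists>t :: int. t\<^sup>2 = int (r' + p') \<and> int c * (int r' + t) = t ^ 3"
    and iso: "digraph_iso (with_proj ?T) (with_proj (sym_tree p' r' c))"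
    unfolding three_main_family_eq by blast
  then have "num_main_eigenvalues (sym_tree p' r' c) = 3"
    by (simp only: num_main_eigenvalues_sym_tree_eq_3_iff)
  moreover have "pair_graph (sym_tree p' r' c)"
    unfolding sym_tree_def by (rule pair_graph_diam5_tree)
  ultimately show "num_main_eigenvalues ?T = 3"
    using num_main_eigenvalues_cong_iso[OF pair_graph_diam5_tree _ iso] by simp
qed

end
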